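(* Let $m\in\mathbb{N}_+$ and $\vartheta=1/\sqrt{m}$. Let $\{\varphi(n)\}_{n\ge1}$ be a positive nondecreasing sequence. Then for (Lebesgue-)almost every $x\in[0,\vartheta]$, $$\limsup_{N\to\infty}\frac{L_N(x)}{\varphi(N)}$$ is either $0$ or $\infty$.
   Context: $\mathbb{N}_+=\{1,2,3,\ldots\}$. Fix $m\in\mathbb{N}_+$ and let $\vartheta>0$ satisfy $\vartheta^2=1/m$. Define $T_\vartheta:[0,\vartheta]\to[0,\vartheta]$ by $T_\vartheta(0)=0$ and $T_\vartheta(x)=\frac1x-\vartheta\left\lfloor\frac1{x\vartheta}\right\rfloor$ for $x\in(0,\vartheta]$. The digits of the $\vartheta$-expansion of $x\in[0,\vartheta]$ are $b_1(x)=\left\lfloor\frac1{x\vartheta}\right\rfloor$ if $x\ne0$, $b_1(0)=\infty$, and $b_n(x)=b_1(T_\vartheta^{n-1}(x))$ for $n\ge2$. For $N\in\mathbb{N}_+$, $L_N(x)=\max_{1\le n\le N}b_n(x)$. *)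

theory Defs
  imports "HOL-Analysis.Analysis"
begin

text \<open>The maps below are total on the reals but are only meaningful for
  \<open>0 < \<theta>\<close> and \<open>x \<in> {0..\<theta>}\<close>, an interval that the Gauss-type map sends into itself.\<close>

definition theta_gauss :: "real \<Rightarrow> real \<Rightarrow> real" where
  "theta_gauss \<theta> x =
     (if x = 0 then 0 else 1 / x - \<theta> * real_of_int \<lfloor>1 / (x * \<theta>)\<rfloor>)"

text \<open>Digits are extended reals because the digit of \<open>0\<close> is \<open>\<infinity>\<close>.\<close>

definition theta_digit1 :: "real \<Rightarrow> real \<Rightarrow> ereal" where
  "theta_digit1 \<theta> x =
     (if x = 0 then \<infinity> else ereal (real_of_int \<lfloor>1 / (x * \<theta>)\<rfloor>))"

text \<open>Digits are indexed from \<open>1\<close>.\<close>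

definition theta_digit :: "real \<Rightarrow> nat \<Rightarrow> real \<Rightarrow> ereal" where
  "theta_digit \<theta> n x = theta_digit1 \<theta> ((theta_gauss \<theta> ^^ (n - 1)) x)"

definition theta_max_digit :: "real \<Rightarrow> nat \<Rightarrow> real \<Rightarrow> ereal" where
  "theta_max_digit \<theta> N x = Max ((\<lambda>n. theta_digit \<theta> n x) ` {1..N})"

end

theory Submission imports Defs begin

text \<open>
  Write \<open>b\<^sub>n\<close> for the digits of \<open>x\<close> and \<open>T\<close> for the Gauss-type map. The dichotomy is decided by the series
  \<open>\<Sum> 1 / \<phi> n\<close>, by a Borel--Bernstein argument.

  \<^item> If the series converges, then for every \<open>\<epsilon> > 0\<close> the sets \<open>{x. b\<^sub>n x \<ge> \<epsilon> * \<phi> n}\<close> have summable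
    measures, so that almost surely \<open>b\<^sub>n < \<epsilon> * \<phi> n\<close> from some index on. Since \<open>\<phi>\<close> is monotone and
    tends to infinity, the running maximum inherits this bound and the limsup is \<open>0\<close>.
  \<^item> If it diverges, then for every \<open>K\<close> almost surely \<open>b\<^sub>n \<ge> K * \<phi> n\<close> infinitely often, and the
    limsup is \<open>\<infinity>\<close>. Bounded sequences \<open>\<phi>\<close> fall under this case.

  Both halves need estimates for the digit \<open>b\<^sub>n\<close> conditionally on the earlier digits, since the
  digits are not independent. Conditionally on its first digits, \<open>T\<^sup>n x\<close> has a density proportional
  to \<open>1 / (1 + s * x)\<^sup>2\<close> for some \<open>s \<in> {0..\<theta>}\<close>: this family of densities contains the uniform one
  (\<open>s = 0\<close>) and is mapped into itself, up to constants, by the inverse branches \<open>y \<mapsto> 1 / (y + \<theta> * i)\<close>, which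
  send the parameter \<open>s\<close> to \<open>1 / (s + \<theta> * i)\<close> (\<open>emeasure_moebius_measure_branch\<close>). All these densities
  lie between \<open>1 / 4\<close> and \<open>1\<close>. Hence a bound on the first digit that is uniform in \<open>s\<close> is a bound on
  every digit given its predecessors, and such bounds multiply
  (\<open>emeasure_moebius_measure_digits_le\<close>)..
\<close>

section \<open>Divergent series of nonnegative reals\<close>

lemma sum_at_top_if_not_summable:
  fixes f :: "nat \<Rightarrow> real"
  assumes nonneg: "\<And>n. 0 \<le> f n" and "\<not> summable f"
  shows "filterlim (\<lambda>N. \<Sum>k<N. f k) at_top sequentially"
  unfolding filterlim_at_top eventually_sequentially
proof
  fix Z
  obtain N where N: "Z \<le> (\<Sum>k<N. f k)"
    using summableI_nonneg_bounded[of f Z] assms by (metis linear)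
  have "Z \<le> (\<Sum>k<n. f k)" if "n \<ge> N" for n
    using N sum_mono2[of "{..<n}" "{..<N}" f] that nonneg by auto
  then show "\<exists>N. \<forall>n\<ge>N. Z \<le> (\<Sum>k<n. f k)" by blast
qed

section \<open>Digits and inverse branches\<close>

locale theta_expansion =
  fixes m :: nat and \<theta> :: real
  assumes m_ge_1: "m \<ge> 1" and theta_eq: "\<theta> = 1 / sqrt (real m)"
begin

lemma theta_pos: "0 < \<theta>"
  using m_ge_1 theta_eq by simp

lemma theta_square: "\<theta> * \<theta> * real m = 1"
  using m_ge_1 by (simp add: theta_eq)

lemma theta_le_1: "\<theta> \<le> 1"
  using m_ge_1 by (simp add: theta_eq)

lemma measurable_theta_gauss [measurable]: "theta_gauss \<theta> \<in> borel_measurable borel"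
  unfolding theta_gauss_def[abs_def] by measurable

lemma measurable_theta_digit1 [measurable]: "theta_digit1 \<theta> \<in> borel_measurable borel"
  unfolding theta_digit1_def[abs_def] by measurable

lemma measurable_theta_digit [measurable]: "theta_digit \<theta> n \<in> borel_measurable borel"
proof -
  have "(theta_gauss \<theta> ^^ k) \<in> borel_measurable borel" for k
    by (induction k) (auto intro: measurable_comp)
  then show ?thesis
    unfolding theta_digit_def[abs_def] by measurable
qed

lemma theta_digit_1: "theta_digit \<theta> (Suc 0) x = theta_digit1 \<theta> x"
  by (simp add: theta_digit_def)

lemma theta_digit_Suc_Suc:
  "theta_digit \<theta> (Suc (Suc k)) x = theta_digit \<theta> (Suc k) (theta_gauss \<theta> x)"
  by (simp add: theta_digit_def funpow_swap1)

lemma theta_digit1_pos_eq: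
  assumes "0 < x" "x \<le> \<theta>"
  obtains i :: nat where "i \<ge> m" "theta_digit1 \<theta> x = ereal (real i)"
proof -
  have "x * \<theta> * real m \<le> 1"
    using theta_square assms theta_pos by (metis mult_right_mono less_imp_le of_nat_0_le_iff)
  then have "real m \<le> 1 / (x * \<theta>)"
    using assms theta_pos by (simp add: field_simps)
  then have ge: "int m \<le> \<lfloor>1 / (x * \<theta>)\<rfloor>"
    by (simp add: le_floor_iff)
  show thesis
  proof
    show "nat \<lfloor>1 / (x * \<theta>)\<rfloor> \<ge> m" using ge by linarith
    show "theta_digit1 \<theta> x = ereal (real (nat \<lfloor>1 / (x * \<theta>)\<rfloor>))"
      using ge assms by (simp add: theta_digit1_def)
  qed
qed

text \<open>Only this inclusion is true of the closed interval: its left endpoint already has digit \<open>i + 1\<close>.\<close>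

lemma theta_branch_interval:
  assumes "i \<ge> m" and i: "theta_digit1 \<theta> x = ereal (real i)" and x: "0 \<le> x"
  shows "x \<in> {1 / (\<theta> * i + \<theta>)..1 / (\<theta> * i)}"
proof -
  have x0: "x > 0" using x i by (cases "x = 0") (auto simp: theta_digit1_def)
  have "\<lfloor>1 / (x * \<theta>)\<rfloor> = int i" using i x0 by (simp add: theta_digit1_def)
  then have "real i \<le> 1 / (x * \<theta>)" "1 / (x * \<theta>) \<le> real i + 1" by linarith+
  then show ?thesis using x0 theta_pos assms(1) m_ge_1 by (simp add: field_simps add_pos_pos)
qed

text \<open>The bound \<open>\<theta>\<close> comes from \<open>\<theta>\<^sup>2 = 1 / m\<close> and \<open>i \<ge> m\<close>. It serves both for points, where \<open>s\<close> is
  the argument of the \<open>i\<close>-th inverse branch, and for the parameter \<open>s\<close> of a density.\<close>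

lemma theta_branch_range:
  assumes "i \<ge> m" "0 \<le> s"
  shows "0 < s + \<theta> * real i" "1 / (s + \<theta> * real i) \<in> {0..\<theta>}"
proof -
  have i: "real i \<ge> 1" "real i \<ge> m" using assms(1) m_ge_1 by auto
  then show pos: "0 < s + \<theta> * real i" using theta_pos assms by (simp add: add_nonneg_pos)
  have "\<theta> * \<theta> * real m \<le> \<theta> * \<theta> * real i"
    using i theta_pos by (intro mult_left_mono) auto
  then have "1 \<le> \<theta> * (\<theta> * i)" using theta_square by (simp add: mult.assoc)
  also have "\<dots> \<le> \<theta> * (s + \<theta> * i)" using assms theta_pos by simp
  finally show "1 / (s + \<theta> * real i) \<in> {0..\<theta>}"
    using pos by (simp add: field_simps)
qed

lemma theta_branch_inverse:
  assumes "i \<ge> m" and y: "0 \<le> y" "y < \<theta>"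
  shows "theta_digit1 \<theta> (1 / (y + \<theta> * i)) = ereal (real i)"
    and "theta_gauss \<theta> (1 / (y + \<theta> * i)) = y"
proof -
  have pos: "0 < y + \<theta> * i" using theta_branch_range assms by auto
  have "(y + \<theta> * i) / \<theta> = y / \<theta> + i" using theta_pos by (simp add: field_simps)
  then have fl: "\<lfloor>1 / (1 / (y + \<theta> * i) * \<theta>)\<rfloor> = int i"
    using y theta_pos by (simp add: floor_eq_iff)
  have ne: "1 / (y + \<theta> * i) \<noteq> 0" using pos by simp
  show "theta_digit1 \<theta> (1 / (y + \<theta> * i)) = ereal (real i)"
    using fl ne unfolding theta_digit1_def by simp
  show "theta_gauss \<theta> (1 / (y + \<theta> * i)) = y"
    using fl ne unfolding theta_gauss_def by simp
qed

text \<open>Change of variables along the decreasing branch \<open>y \<mapsto> 1 / (y + a)\<close>. The substitution rule for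
  nonnegative integrals is for increasing maps, so both sides are reflected at \<open>0\<close> first.\<close>

lemma nn_integral_inverse_substitution:
  fixes h :: "real \<Rightarrow> ennreal"
  assumes [measurable]: "h \<in> borel_measurable borel" and a: "0 < a"
  shows "(\<integral>\<^sup>+x. h x * indicator {1 / (a + \<theta>)..1 / a} x \<partial>lborel)
       = (\<integral>\<^sup>+y. h (1 / (y + a)) * ennreal (1 / (y + a)\<^sup>2) * indicator {0..\<theta>} y \<partial>lborel)"
proof -
  let ?g = "\<lambda>y. - (1 / (y + a))"
  have "(\<integral>\<^sup>+x. h x * indicator {1 / (a + \<theta>)..1 / a} x \<partial>lborel)
      = (\<integral>\<^sup>+x. h (- x) * indicator {1 / (a + \<theta>)..1 / a} (- x) \<partial>lborel)"
    using nn_integral_real_affine[of "\<lambda>x. h x * indicator {1 / (a + \<theta>)..1 / a} x" "-1" 0]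
    by simp
  also have "\<dots> = (\<integral>\<^sup>+x. h (- x) * indicator {?g 0..?g \<theta>} x \<partial>lborel)"
    by (intro nn_integral_cong) (auto simp: indicator_def add.commute)
  also have "\<dots> = (\<integral>\<^sup>+y. h (- ?g y) * ennreal (1 / (y + a)\<^sup>2) * indicator {0..\<theta>} y \<partial>lborel)"
  proof (rule nn_integral_substitution_aux[where f = "\<lambda>x. h (- x)" and g = ?g])
  qed (use a theta_pos in \<open>auto intro!: derivative_eq_intros continuous_intros simp: power2_eq_square\<close>)
  finally show ?thesis by simp
qed

section \<open>Densities preserved by the inverse branches\<close>

text \<open>Up to normalisation this is the law of \<open>T\<^sup>n x\<close> given the first \<open>n\<close> digits of a uniformly
  distributed \<open>x\<close>, for an \<open>s\<close> that depends on those digits. Leaving it unnormalised keeps the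
  formula for the branches below a plain identity.\<close>

definition moebius_measure :: "real \<Rightarrow> real measure" where
  "moebius_measure s = density lborel (\<lambda>x. ennreal (indicator {0..\<theta>} x / (1 + s * x)\<^sup>2))"

lemma sets_moebius_measure [simp, measurable_cong]: "sets (moebius_measure s) = sets borel"
  and space_moebius_measure [simp]: "space (moebius_measure s) = UNIV"
  by (simp_all add: moebius_measure_def)

lemma emeasure_moebius_measure:
  assumes "A \<in> sets borel"
  shows "emeasure (moebius_measure s) A =
    (\<integral>\<^sup>+x. ennreal (indicator {0..\<theta>} x / (1 + s * x)\<^sup>2) * indicator A x \<partial>lborel)"
  unfolding moebius_measure_def using assms by (subst emeasure_density) auto

lemma emeasure_moebius_measure_Int:
  assumes "A \<in> sets borel"
  shows "emeasure (moebius_measure s) A = emeasure (moebius_measure s) (A \<inter> {0..\<theta>})"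
  using assms by (simp add: emeasure_moebius_measure)
    (auto intro!: nn_integral_cong simp: indicator_def)

lemma emeasure_moebius_measure_singleton: "emeasure (moebius_measure s) {x} = 0"
  by (simp add: emeasure_moebius_measure nn_integral_0_iff_AE AE_lborel_singleton)

lemma emeasure_moebius_measure_le:
  assumes "A \<in> sets borel" "0 \<le> s"
  shows "emeasure (moebius_measure s) A \<le> emeasure lborel (A \<inter> {0..\<theta>})"
proof -
  have "emeasure (moebius_measure s) A \<le> (\<integral>\<^sup>+x. indicator (A \<inter> {0..\<theta>}) x \<partial>lborel)"
    unfolding emeasure_moebius_measure[OF assms(1)]
  proof (rule nn_integral_mono)
    fix x
    have "1 / (1 + s * x)\<^sup>2 \<le> 1" if "0 \<le> x"
      using that assms by (simp add: divide_le_eq_1 one_le_power)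
    then show "ennreal (indicator {0..\<theta>} x / (1 + s * x)\<^sup>2) * indicator A x
        \<le> indicator (A \<inter> {0..\<theta>}) x"
      by (auto simp: indicator_def ennreal_le_1)
  qed
  then show ?thesis using assms by simp
qed

lemma emeasure_moebius_measure_ge:
  assumes A: "A \<in> sets borel" "A \<subseteq> {0..\<theta>}" and s: "s \<in> {0..\<theta>}"
  shows "ennreal (1 / 4) * emeasure lborel A \<le> emeasure (moebius_measure s) A"
proof -
  have "(\<integral>\<^sup>+x. ennreal (1 / 4) * indicator A x \<partial>lborel) \<le> emeasure (moebius_measure s) A"
    unfolding emeasure_moebius_measure[OF A(1)]
  proof (rule nn_integral_mono)
    fix x
    have "1 / 4 \<le> 1 / (1 + s * x)\<^sup>2" if "x \<in> A"
    proof -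
      have x: "0 \<le> x" "x \<le> 1" using that A theta_le_1 by force+
      have "s * x \<le> 1 * 1" using s x theta_le_1 by (intro mult_mono) auto
      moreover have "0 \<le> s * x" using s x by simp
      ultimately have "(1 + s * x)\<^sup>2 \<le> 2\<^sup>2"
        by (intro power_mono) auto
      moreover have "0 < (1 + s * x)\<^sup>2"
        using \<open>0 \<le> s * x\<close> by simp
      ultimately show ?thesis by (simp add: field_simps)
    qed
    then show "ennreal (1 / 4) * indicator A x
        \<le> ennreal (indicator {0..\<theta>} x / (1 + s * x)\<^sup>2) * indicator A x"
      using A by (auto simp: indicator_def intro!: ennreal_leI)
  qed
  then show ?thesis using A by (simp add: nn_integral_cmult)
qed

text \<open>The reason for choosing these densities: for \<open>x = 1 / (y + a)\<close> one has
  \<open>1 / (1 + s * x)\<^sup>2 * (1 / (y + a)\<^sup>2) = 1 / (s + a + y)\<^sup>2\<close>, which is again a multiple of a density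
  from the family, with parameter \<open>1 / (s + a)\<close>.\<close>

lemma emeasure_moebius_measure_branch:
  assumes i: "i \<ge> m" and s: "0 \<le> s" and [measurable]: "S \<in> sets borel"
  shows "emeasure (moebius_measure s) {x. theta_digit1 \<theta> x = ereal (real i) \<and> theta_gauss \<theta> x \<in> S}
    = ennreal (1 / (s + \<theta> * i)\<^sup>2) * emeasure (moebius_measure (1 / (s + \<theta> * i))) S"
    (is "emeasure _ ?A = _")
proof -
  define a where "a = \<theta> * real i"
  have a: "0 < a" using theta_branch_range[OF i, of 0] by (simp add: a_def)
  define h where "h x = ennreal (1 / (1 + s * x)\<^sup>2) * indicator S (theta_gauss \<theta> x)" for x
  have [measurable]: "h \<in> borel_measurable borel" unfolding h_def by measurable
  have [measurable]: "?A \<in> sets borel" by measurable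
  have "emeasure (moebius_measure s) ?A =
      (\<integral>\<^sup>+x. h x * indicator {1 / (a + \<theta>)..1 / a} x \<partial>lborel)"
    unfolding emeasure_moebius_measure[OF \<open>?A \<in> sets borel\<close>]
  proof (rule nn_integral_cong_AE)
    show "AE x in lborel. ennreal (indicator {0..\<theta>} x / (1 + s * x)\<^sup>2) * indicator ?A x
      = h x * indicator {1 / (a + \<theta>)..1 / a} x"
      \<comment> \<open>The endpoint \<open>1 / (a + \<theta>)\<close> belongs to the next branch.\<close>
      using AE_lborel_singleton[of "1 / (a + \<theta>)"]
    proof eventually_elim
      case (elim x)
      show ?case
      proof (cases "x \<in> {1 / (a + \<theta>)..1 / a}")
        case True
        then have x0: "0 < x" using a theta_pos
          by (meson add_pos_pos atLeastAtMost_iff less_le_trans zero_less_divide_1_iff)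
        define y where "y = 1 / x - a"
        have y: "0 \<le> y" "y < \<theta>" using True elim x0 a theta_pos unfolding y_def
          by (auto simp: field_simps add_pos_pos)
        have x: "x = 1 / (y + \<theta> * i)" using x0 by (simp add: y_def a_def)
        show ?thesis
          using True theta_branch_inverse[OF i y] theta_branch_range(2)[OF i y(1)]
          by (simp add: h_def indicator_def flip: x)
      next
        case False
        then have "\<not> (x \<in> {0..\<theta>} \<and> x \<in> ?A)"
          using theta_branch_interval[OF i, of x] by (auto simp: a_def)
        then show ?thesis using False by (auto simp: indicator_def)
      qed
    qed
  qed
  also have "\<dots> = (\<integral>\<^sup>+y. h (1 / (y + a)) * ennreal (1 / (y + a)\<^sup>2) * indicator {0..\<theta>} y \<partial>lborel)"
    by (rule nn_integral_inverse_substitution[OF _ a]) simp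
  also have "\<dots> = (\<integral>\<^sup>+y. ennreal (1 / (s + a)\<^sup>2) *
      (ennreal (indicator {0..\<theta>} y / (1 + 1 / (s + a) * y)\<^sup>2) * indicator S y) \<partial>lborel)"
  proof (rule nn_integral_cong_AE)
    show "AE y in lborel. h (1 / (y + a)) * ennreal (1 / (y + a)\<^sup>2) * indicator {0..\<theta>} y =
      ennreal (1 / (s + a)\<^sup>2) *
        (ennreal (indicator {0..\<theta>} y / (1 + 1 / (s + a) * y)\<^sup>2) * indicator S y)"
      using AE_lborel_singleton[of \<theta>]
    proof eventually_elim
      case (elim y)
      show ?case
      proof (cases "y \<in> {0..\<theta>}")
        case True
        then have y: "0 \<le> y" "y < \<theta>" using elim by auto
        have "1 / (1 + s * (1 / (y + a)))\<^sup>2 * (1 / (y + a)\<^sup>2) = 1 / (s + a + y)\<^sup>2"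
          using a y s by (simp add: field_simps power_mult_distrib[symmetric])
        also have "\<dots> = 1 / (s + a)\<^sup>2 * (1 / (1 + 1 / (s + a) * y)\<^sup>2)"
          using a y s by (simp add: field_simps power_mult_distrib[symmetric])
        finally show ?thesis
          using True theta_branch_inverse(2)[OF i y]
          by (simp add: h_def a_def indicator_def flip: ennreal_mult)
      qed simp
    qed
  qed
  also have "\<dots> = ennreal (1 / (s + a)\<^sup>2) * emeasure (moebius_measure (1 / (s + a))) S"
    by (subst nn_integral_cmult) (simp_all add: emeasure_moebius_measure)
  finally show ?thesis by (simp add: a_def)
qed

text \<open>Split according to the first digit \<open>i\<close>. On each piece the measure of the preimage of \<open>S\<close> is a
  multiple of a measure of \<open>S\<close> from the family, with the same factor that relates the whole piece to
  the total mass. So a bound for \<open>S\<close> that holds throughout the family passes to every piece. The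
  point \<open>0\<close>, whose digit is infinite, is in no piece, but it is a null set.\<close>

lemma emeasure_moebius_measure_lift:
  assumes [measurable]: "S \<in> sets borel" "D \<in> sets borel"
    and s: "s \<in> {0..\<theta>}"
    and le: "\<And>s. s \<in> {0..\<theta>} \<Longrightarrow>
      emeasure (moebius_measure s) S \<le> c * emeasure (moebius_measure s) UNIV"
  shows "emeasure (moebius_measure s) {x. theta_digit1 \<theta> x \<in> D \<and> theta_gauss \<theta> x \<in> S}
    \<le> c * emeasure (moebius_measure s) {x. theta_digit1 \<theta> x \<in> D}"
proof -
  let ?\<nu> = "emeasure (moebius_measure s)"
  define E where "E T i = (if i \<ge> m \<and> ereal (real i) \<in> D
    then {x. theta_digit1 \<theta> x = ereal (real i) \<and> theta_gauss \<theta> x \<in> T} else {})" for T i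
  have [measurable]: "E T i \<in> sets borel" if [measurable]: "T \<in> sets borel" for T i
  proof -
    have "{x. theta_digit1 \<theta> x = ereal (real i) \<and> theta_gauss \<theta> x \<in> T} \<in> sets borel"
      by measurable
    then show ?thesis by (simp add: E_def)
  qed
  have E_le: "?\<nu> (E S i) \<le> c * ?\<nu> (E UNIV i)" for i
  proof (cases "i \<ge> m \<and> ereal (real i) \<in> D")
    case True
    then have i: "i \<ge> m" by simp
    have "ennreal (1 / (s + \<theta> * i)\<^sup>2) * emeasure (moebius_measure (1 / (s + \<theta> * i))) S
      \<le> ennreal (1 / (s + \<theta> * i)\<^sup>2) * (c * emeasure (moebius_measure (1 / (s + \<theta> * i))) UNIV)"
      using theta_branch_range(2)[OF i] s by (intro mult_left_mono le) auto
    then show ?thesis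
      using True s emeasure_moebius_measure_branch[OF i, of s S]
        emeasure_moebius_measure_branch[OF i, of s UNIV]
      by (simp add: E_def mult_ac)
  qed (auto simp: E_def)
  have "?\<nu> {x. theta_digit1 \<theta> x \<in> D \<and> theta_gauss \<theta> x \<in> S}
      = ?\<nu> ({x. theta_digit1 \<theta> x \<in> D \<and> theta_gauss \<theta> x \<in> S} \<inter> {0..\<theta>})"
    by (rule emeasure_moebius_measure_Int) measurable
  also have "\<dots> \<le> ?\<nu> ({0} \<union> (\<Union>i. E S i))"
  proof (rule emeasure_mono)
    show "{x. theta_digit1 \<theta> x \<in> D \<and> theta_gauss \<theta> x \<in> S} \<inter> {0..\<theta>} \<subseteq> {0} \<union> (\<Union>i. E S i)"
    proof
      fix x assume x: "x \<in> {x. theta_digit1 \<theta> x \<in> D \<and> theta_gauss \<theta> x \<in> S} \<inter> {0..\<theta>}"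
      show "x \<in> {0} \<union> (\<Union>i. E S i)"
      proof (cases "x = 0")
        case False
        then obtain i where "i \<ge> m" "theta_digit1 \<theta> x = ereal (real i)"
          using x theta_digit1_pos_eq[of x] by auto
        then have "x \<in> E S i" using x by (auto simp: E_def)
        then show ?thesis by blast
      qed simp
    qed
  qed measurable
  also have "\<dots> \<le> ?\<nu> {0} + ?\<nu> (\<Union>i. E S i)"
    by (rule emeasure_subadditive) auto
  also have "\<dots> = ?\<nu> (\<Union>i. E S i)"
    by (simp add: emeasure_moebius_measure_singleton)
  also have "\<dots> \<le> (\<Sum>i. ?\<nu> (E S i))"
    by (rule emeasure_subadditive_countably) auto
  also have "\<dots> \<le> (\<Sum>i. c * ?\<nu> (E UNIV i))"
    by (intro suminf_le E_le) auto
  also have "\<dots> = c * (\<Sum>i. ?\<nu> (E UNIV i))"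
    by simp
  also have "(\<Sum>i. ?\<nu> (E UNIV i)) = ?\<nu> (\<Union>i. E UNIV i)"
    by (rule suminf_emeasure) (auto simp: disjoint_family_on_def E_def)
  also have "\<dots> \<le> ?\<nu> {x. theta_digit1 \<theta> x \<in> D}"
    by (rule emeasure_mono) (auto simp: E_def split: if_splits)
  finally show ?thesis by (simp add: mult_left_mono)
qed

text \<open>This replaces independence of the digits. Taking \<open>D k = UNIV\<close> and \<open>c k = 1\<close> leaves a digit
  unconstrained.\<close>

lemma emeasure_moebius_measure_digits_le:
  assumes D: "\<And>k. D k \<in> sets borel"
    and le: "\<And>k s. s \<in> {0..\<theta>} \<Longrightarrow>
      emeasure (moebius_measure s) {x. theta_digit1 \<theta> x \<in> D k} \<le> c k * emeasure (moebius_measure s) UNIV"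
    and s: "s \<in> {0..\<theta>}"
  shows "emeasure (moebius_measure s) {x. \<forall>k<n. theta_digit \<theta> (Suc k) x \<in> D k}
    \<le> (\<Prod>k<n. c k) * emeasure (moebius_measure s) UNIV"
  using assms
proof (induction n arbitrary: D c s)
  case 0
  then show ?case by simp
next
  case (Suc n)
  note [measurable] = Suc.prems(1)
  let ?S = "{x. \<forall>k<n. theta_digit \<theta> (Suc k) x \<in> D (Suc k)}"
  have [measurable]: "?S \<in> sets borel" by measurable
  have split: "{x. \<forall>k<Suc n. theta_digit \<theta> (Suc k) x \<in> D k}
      = {x. theta_digit1 \<theta> x \<in> D 0 \<and> theta_gauss \<theta> x \<in> ?S}"
    by (auto simp: less_Suc_eq_0_disj theta_digit_1 theta_digit_Suc_Suc)
  have "emeasure (moebius_measure s) {x. \<forall>k<Suc n. theta_digit \<theta> (Suc k) x \<in> D k}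
      \<le> (\<Prod>k<n. c (Suc k)) * emeasure (moebius_measure s) {x. theta_digit1 \<theta> x \<in> D 0}"
    unfolding split
    by (rule emeasure_moebius_measure_lift)
      (use Suc.prems in \<open>auto intro!: Suc.IH[of "\<lambda>k. D (Suc k)" "\<lambda>k. c (Suc k)"]\<close>)
  also have "\<dots> \<le> (\<Prod>k<n. c (Suc k)) * (c 0 * emeasure (moebius_measure s) UNIV)"
    by (intro mult_left_mono Suc.prems) auto
  also have "\<dots> = (\<Prod>k<Suc n. c k) * emeasure (moebius_measure s) UNIV"
    by (simp add: prod.lessThan_Suc_shift mult_ac del: prod.lessThan_Suc)
  finally show ?case .
qed

section \<open>Tail bounds for a single digit\<close>

lemma emeasure_moebius_measure_UNIV_bounds:
  assumes "s \<in> {0..\<theta>}"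
  shows "ennreal (\<theta> / 4) \<le> emeasure (moebius_measure s) UNIV"
    and "emeasure (moebius_measure s) UNIV \<le> ennreal \<theta>"
proof -
  have "ennreal (\<theta> / 4) = ennreal (1 / 4) * emeasure lborel {0..\<theta>}"
    using theta_pos by (simp flip: ennreal_mult)
  also have "\<dots> \<le> emeasure (moebius_measure s) {0..\<theta>}"
    using assms by (intro emeasure_moebius_measure_ge) auto
  also have "\<dots> \<le> emeasure (moebius_measure s) UNIV"
    by (intro emeasure_mono) auto
  finally show "ennreal (\<theta> / 4) \<le> emeasure (moebius_measure s) UNIV" .
  show "emeasure (moebius_measure s) UNIV \<le> ennreal \<theta>"
    using emeasure_moebius_measure_le[of UNIV s] assms theta_pos by simp
qed

text \<open>A first digit at least \<open>t\<close> forces \<open>x \<le> 1 / (t * \<theta>)\<close>, and the densities lie between \<open>1 / 4\<close> and \<open>1\<close>,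
  so the proportion of such points in \<open>{0..\<theta>}\<close> is at most \<open>4 / (t * \<theta>\<^sup>2)\<close>.\<close>

lemma emeasure_moebius_measure_digit_ge:
  assumes t: "0 < t" and s: "s \<in> {0..\<theta>}"
  shows "emeasure (moebius_measure s) {x. theta_digit1 \<theta> x \<in> {ereal t..}}
    \<le> ennreal (4 * m / t) * emeasure (moebius_measure s) UNIV"
proof -
  have "{x. theta_digit1 \<theta> x \<in> {ereal t..}} \<inter> {0..\<theta>} \<subseteq> {0..1 / (t * \<theta>)}"
  proof
    fix x assume x: "x \<in> {x. theta_digit1 \<theta> x \<in> {ereal t..}} \<inter> {0..\<theta>}"
    show "x \<in> {0..1 / (t * \<theta>)}"
    proof (cases "x = 0")
      case False
      then have "t \<le> 1 / (x * \<theta>)"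
        using x by (auto simp: theta_digit1_def) linarith
      then show ?thesis using False x t theta_pos by (simp add: field_simps)
    qed (use t theta_pos in auto)
  qed
  then have "emeasure lborel ({x. theta_digit1 \<theta> x \<in> {ereal t..}} \<inter> {0..\<theta>})
      \<le> emeasure lborel {0..1 / (t * \<theta>)}"
    by (intro emeasure_mono) auto
  moreover have "emeasure (moebius_measure s) {x. theta_digit1 \<theta> x \<in> {ereal t..}}
      \<le> emeasure lborel ({x. theta_digit1 \<theta> x \<in> {ereal t..}} \<inter> {0..\<theta>})"
    using s by (intro emeasure_moebius_measure_le) auto
  ultimately have "emeasure (moebius_measure s) {x. theta_digit1 \<theta> x \<in> {ereal t..}}
      \<le> ennreal (1 / (t * \<theta>))"
    using t theta_pos by simp
  also have "1 / (t * \<theta>) = 4 * m / t * (\<theta> / 4)"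
    using t theta_pos theta_square by (simp add: field_simps)
  also have "ennreal (4 * m / t * (\<theta> / 4)) = ennreal (4 * m / t) * ennreal (\<theta> / 4)"
    using t theta_pos by (intro ennreal_mult) auto
  also have "\<dots> \<le> ennreal (4 * m / t) * emeasure (moebius_measure s) UNIV"
    by (intro mult_left_mono emeasure_moebius_measure_UNIV_bounds s) simp
  finally show ?thesis .
qed

text \<open>Every \<open>x\<close> in \<open>{0<..\<theta> / (t + 1)}\<close> has \<open>1 / (x * \<theta>) \<ge> t + 1\<close>, hence first digit at least \<open>t\<close>. This
  interval carries at least the proportion \<open>1 / (4 * (t + 1))\<close> of the total mass.\<close>

lemma emeasure_moebius_measure_digit_less:
  assumes t: "0 < t" and s: "s \<in> {0..\<theta>}"
  shows "emeasure (moebius_measure s) {x. theta_digit1 \<theta> x \<in> {..<ereal t}}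
    \<le> ennreal (1 - 1 / (4 * (t + 1))) * emeasure (moebius_measure s) UNIV"
proof -
  let ?\<nu> = "emeasure (moebius_measure s)" and ?A = "{x. theta_digit1 \<theta> x \<in> {..<ereal t}}"
  define d where "d = \<theta> / (t + 1)"
  have d: "0 < d" "d \<le> \<theta>" using t theta_pos by (auto simp: d_def field_simps)
  have "\<theta> * \<theta> * 1 \<le> \<theta> * \<theta> * m" using m_ge_1 theta_pos by (intro mult_left_mono) auto
  then have sq: "\<theta> * \<theta> \<le> 1" using theta_square by simp
  have disj: "?A \<inter> {0<..d} = {}"
  proof -
    have "ereal t \<le> theta_digit1 \<theta> x" if "0 < x" "x \<le> d" for x
    proof -
      have "x * (\<theta> * (t + 1)) \<le> d * (\<theta> * (t + 1))"
        using that t theta_pos by (intro mult_right_mono) auto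
      also have "\<dots> \<le> 1" using sq t by (simp add: d_def)
      finally have "t + 1 \<le> 1 / (x * \<theta>)" using that theta_pos by (simp add: field_simps)
      then have "t \<le> of_int \<lfloor>1 / (x * \<theta>)\<rfloor>" by linarith
      then show ?thesis by (simp add: theta_digit1_def)
    qed
    then show ?thesis by (fastforce simp: not_le[symmetric])
  qed
  have fin: "?\<nu> UNIV < \<infinity>"
    using emeasure_moebius_measure_UNIV_bounds(2)[OF s] by (simp add: le_less_trans)
  then interpret finite_measure "moebius_measure s"
    by (intro finite_measureI) (simp add: less_top)
  define M where "M = measure (moebius_measure s) UNIV"
  have M: "?\<nu> UNIV = ennreal M" by (simp add: M_def emeasure_eq_measure)
  have "M \<le> \<theta>"
    using emeasure_moebius_measure_UNIV_bounds(2)[OF s] theta_pos unfolding M by simp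
  have "ennreal (d / 4) = ennreal (1 / 4) * emeasure lborel {0<..d}"
    using d by (simp flip: ennreal_mult)
  also have "\<dots> \<le> ?\<nu> {0<..d}"
    using d s by (intro emeasure_moebius_measure_ge) auto
  finally have "d / 4 \<le> measure (moebius_measure s) {0<..d}"
    by (simp add: emeasure_eq_measure)
  moreover have "measure (moebius_measure s) ?A + measure (moebius_measure s) {0<..d} \<le> M"
    unfolding M_def using finite_measure_Union[OF _ _ disj]
      finite_measure_mono[of "?A \<union> {0<..d}" UNIV] by simp
  moreover have "M * (1 / (4 * (t + 1))) \<le> d / 4"
  proof -
    have "d / 4 = \<theta> * (1 / (4 * (t + 1)))" by (simp add: d_def mult.commute)
    then show ?thesis using \<open>M \<le> \<theta>\<close> t by (simp only:) (intro mult_right_mono; simp)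
  qed
  ultimately have "measure (moebius_measure s) ?A \<le> M - M * (1 / (4 * (t + 1)))"
    by linarith
  then have "measure (moebius_measure s) ?A \<le> (1 - 1 / (4 * (t + 1))) * M"
    by (simp add: left_diff_distrib)
  moreover have "0 \<le> 1 - 1 / (4 * (t + 1))" "0 \<le> M"
    using t by (auto simp: field_simps M_def)
  ultimately show ?thesis
    unfolding M by (simp add: emeasure_eq_measure flip: ennreal_mult)
qed

section \<open>Borel--Bernstein theorem\<close>

lemma AE_moebius_measure_0_iff:
  "(AE x in moebius_measure 0. P x) \<longleftrightarrow> (AE x in lebesgue_on {0..\<theta>}. P x)"
proof -
  have "(AE x in moebius_measure 0. P x) \<longleftrightarrow> (AE x in lborel. x \<in> {0..\<theta>} \<longrightarrow> P x)"
    unfolding moebius_measure_def by (subst AE_density) (auto simp: indicator_def)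
  also have "\<dots> \<longleftrightarrow> (AE x in lebesgue_on {0..\<theta>}. P x)"
    by (subst AE_restrict_space_iff) (auto simp: AE_completion_iff)
  finally show ?thesis .
qed

lemma emeasure_moebius_measure_0_finite:
  "emeasure (moebius_measure 0) A < \<infinity>"
proof -
  have "emeasure (moebius_measure 0) A \<le> emeasure (moebius_measure 0) (space (moebius_measure 0))"
    by (rule emeasure_space)
  also have "\<dots> \<le> ennreal \<theta>"
    using emeasure_moebius_measure_UNIV_bounds(2)[of 0] theta_pos by simp
  finally show ?thesis by (simp add: le_less_trans)
qed

text \<open>The convergence half: the first Borel--Cantelli lemma, with the earlier digits left free in the
  product bound.\<close>

lemma AE_digits_eventually_less:
  assumes t: "\<And>n. 0 < t n" and "summable (\<lambda>n. 1 / t n)"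
  shows "AE x in lebesgue_on {0..\<theta>}.
    eventually (\<lambda>n. theta_digit \<theta> (Suc n) x < ereal (t n)) sequentially"
proof -
  define A where "A n = {x. ereal (t n) \<le> theta_digit \<theta> (Suc n) x}" for n
  have [measurable]: "A n \<in> sets borel" for n
    unfolding A_def by measurable
  have le: "measure (moebius_measure 0) (A n) \<le> 4 * m * \<theta> * (1 / t n)" for n
  proof -
    define D where "D k = (if k = n then {ereal (t n)..} else UNIV)" for k
    have "emeasure (moebius_measure 0) (A n)
        \<le> emeasure (moebius_measure 0) {x. \<forall>k<Suc n. theta_digit \<theta> (Suc k) x \<in> D k}"
    proof (rule emeasure_mono)
      have [measurable]: "D k \<in> sets borel" for k by (simp add: D_def)
      show "{x. \<forall>k<Suc n. theta_digit \<theta> (Suc k) x \<in> D k} \<in> sets (moebius_measure 0)"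
        by measurable
    qed (auto simp: A_def D_def)
    also have "\<dots> \<le> (\<Prod>k<Suc n. if k = n then ennreal (4 * m / t n) else 1) *
        emeasure (moebius_measure 0) UNIV"
    proof (rule emeasure_moebius_measure_digits_le)
      show "emeasure (moebius_measure s) {x. theta_digit1 \<theta> x \<in> D k}
        \<le> (if k = n then ennreal (4 * m / t n) else 1) * emeasure (moebius_measure s) UNIV"
        if "s \<in> {0..\<theta>}" for k s
        using emeasure_moebius_measure_digit_ge[OF t that, of n] by (simp add: D_def)
    qed (use theta_pos in \<open>auto simp: D_def\<close>)
    also have "\<dots> = ennreal (4 * m / t n) * emeasure (moebius_measure 0) UNIV"
      by simp
    also have "\<dots> \<le> ennreal (4 * m / t n) * ennreal \<theta>"
      using theta_pos by (intro mult_left_mono emeasure_moebius_measure_UNIV_bounds) auto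
    also have "\<dots> = ennreal (4 * m * \<theta> * (1 / t n))"
      using t[of n] theta_pos by (simp flip: ennreal_mult)
    finally show ?thesis
      unfolding measure_def using t[of n] theta_pos by (intro enn2real_leI) auto
  qed
  have "summable (\<lambda>n. measure (moebius_measure 0) (A n))"
  proof (rule summable_comparison_test')
    show "summable (\<lambda>n. 4 * m * \<theta> * (1 / t n))"
      by (rule summable_mult[OF assms(2)])
    show "norm (measure (moebius_measure 0) (A n)) \<le> 4 * m * \<theta> * (1 / t n)" for n
      using le[of n] by simp
  qed
  then have "AE x in moebius_measure 0.
      eventually (\<lambda>n. x \<in> space (moebius_measure 0) - A n) sequentially"
    by (intro borel_cantelli_AE1 emeasure_moebius_measure_0_finite) auto
  then show ?thesis
    unfolding AE_moebius_measure_0_iff[symmetric] by (simp add: A_def not_le)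
qed

text \<open>The divergence half: the chance that all digits from \<open>n\<close> to \<open>n + N - 1\<close> stay below their
  thresholds is at most a product of factors \<open>1 - c k\<close>, which is dominated by \<open>exp (- \<Sum> c k)\<close> and tends
  to \<open>0\<close> as \<open>N\<close> grows. The shift in \<open>t n + 1\<close> comes from the floor function and matters only where \<open>t\<close> is small.\<close>

lemma AE_digits_frequently_ge:
  assumes t: "\<And>n. 0 < t n" and "\<not> summable (\<lambda>n. 1 / (t n + 1))"
  shows "AE x in lebesgue_on {0..\<theta>}.
    frequently (\<lambda>n. ereal (t n) \<le> theta_digit \<theta> (Suc n) x) sequentially"
proof -
  let ?\<nu> = "moebius_measure 0"
  define c where "c n = 1 / (4 * (t n + 1))" for n
  have c: "0 \<le> c n" "c n \<le> 1" for n using t[of n] by (auto simp: c_def field_simps)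
  define B where "B n = {x. \<forall>k\<ge>n. theta_digit \<theta> (Suc k) x < ereal (t k)}" for n
  have [measurable]: "B n \<in> sets borel" for n
    unfolding B_def by measurable
  have null: "emeasure ?\<nu> (B n) = 0" for n
  proof -
    have nonsum: "\<not> summable (\<lambda>k. c (k + n))"
    proof
      assume "summable (\<lambda>k. c (k + n))"
      then have "summable (\<lambda>k. 4 * c k)" by (intro summable_mult) (simp only: summable_iff_shift)
      moreover have "4 * c k = 1 / (t k + 1)" for k using t[of k] by (simp add: c_def field_simps)
      ultimately show False using assms(2) by simp
    qed
    have le: "emeasure ?\<nu> (B n) \<le> ennreal (exp (- (\<Sum>k<N. c (k + n))) * \<theta>)" for N
    proof -
      define D where "D k = (if n \<le> k then {..<ereal (t k)} else UNIV)" for k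
      have "emeasure ?\<nu> (B n)
          \<le> emeasure ?\<nu> {x. \<forall>k<n + N. theta_digit \<theta> (Suc k) x \<in> D k}"
      proof (rule emeasure_mono)
        have [measurable]: "D k \<in> sets borel" for k by (simp add: D_def)
        show "{x. \<forall>k<n + N. theta_digit \<theta> (Suc k) x \<in> D k} \<in> sets ?\<nu>"
          by measurable
      qed (auto simp: B_def D_def)
      also have "\<dots> \<le> (\<Prod>k<n + N. if n \<le> k then ennreal (1 - c k) else 1) * emeasure ?\<nu> UNIV"
      proof (rule emeasure_moebius_measure_digits_le)
        show "emeasure (moebius_measure s) {x. theta_digit1 \<theta> x \<in> D k}
          \<le> (if n \<le> k then ennreal (1 - c k) else 1) * emeasure (moebius_measure s) UNIV"
          if "s \<in> {0..\<theta>}" for k s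
          using emeasure_moebius_measure_digit_less[OF t that, of k] unfolding c_def D_def by simp
      qed (use theta_pos in \<open>auto simp: D_def\<close>)
      also have "(\<Prod>k<n + N. if n \<le> k then ennreal (1 - c k) else 1)
          = (\<Prod>k<N. ennreal (1 - c (k + n)))"
        by (induction N) (auto simp: add.commute lessThan_Suc_eq_insert_0[symmetric])
      also have "\<dots> = ennreal (\<Prod>k<N. 1 - c (k + n))"
        using c by (intro prod_ennreal) auto
      also have "\<dots> \<le> ennreal (\<Prod>k<N. exp (- c (k + n)))"
        using c exp_ge_add_one_self[of "- c _"] by (intro ennreal_leI prod_mono) auto
      also have "(\<Prod>k<N. exp (- c (k + n))) = exp (- (\<Sum>k<N. c (k + n)))"
        by (simp add: exp_sum flip: sum_negf)
      also have "ennreal (exp (- (\<Sum>k<N. c (k + n)))) * emeasure ?\<nu> UNIV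
          \<le> ennreal (exp (- (\<Sum>k<N. c (k + n)))) * ennreal \<theta>"
        using theta_pos by (intro mult_left_mono emeasure_moebius_measure_UNIV_bounds) auto
      finally show ?thesis using theta_pos by (simp flip: ennreal_mult add: mult_right_mono)
    qed
    have "filterlim (\<lambda>N. \<Sum>k<N. c (k + n)) at_top sequentially"
      using nonsum c by (intro sum_at_top_if_not_summable)
    then have "(\<lambda>N. exp (- (\<Sum>k<N. c (k + n)))) \<longlonglongrightarrow> 0"
      by (intro filterlim_compose[OF exp_at_bot]) (simp add: filterlim_uminus_at_bot)
    then have "(\<lambda>N. ennreal (exp (- (\<Sum>k<N. c (k + n))) * \<theta>)) \<longlonglongrightarrow> ennreal (0 * \<theta>)"
      by (intro tendsto_ennrealI tendsto_mult tendsto_const)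
    then have "emeasure ?\<nu> (B n) \<le> ennreal (0 * \<theta>)"
      by (rule LIMSEQ_le_const) (use le in auto)
    then show ?thesis by simp
  qed
  then have "AE x in ?\<nu>. \<forall>n. x \<notin> B n"
    by (subst AE_all_countable) (auto intro!: AE_not_in null_setsI)
  then have "AE x in ?\<nu>. frequently (\<lambda>n. ereal (t n) \<le> theta_digit \<theta> (Suc n) x) sequentially"
    by eventually_elim (auto simp: B_def frequently_sequentially not_less)
  then show ?thesis by (simp add: AE_moebius_measure_0_iff)
qed

end

section \<open>From digits to running maxima\<close>

text \<open>An infinite digit means that the orbit has reached the fixed point \<open>0\<close>. Consequently, if late
  digits are finite then all digits are, which keeps the running maximum finite.\<close>

lemma theta_digit_infinity_stays:
  assumes "theta_digit \<theta> (Suc n) x = \<infinity>" "n \<le> k"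
  shows "theta_digit \<theta> (Suc k) x = \<infinity>"
proof -
  have "(theta_gauss \<theta> ^^ n) x = 0"
    using assms(1) by (auto simp: theta_digit_def theta_digit1_def split: if_splits)
  moreover have "(theta_gauss \<theta> ^^ j) 0 = 0" for j
    by (induction j) (auto simp: theta_gauss_def)
  moreover have "(theta_gauss \<theta> ^^ k) x = (theta_gauss \<theta> ^^ (k - n)) ((theta_gauss \<theta> ^^ n) x)"
    using assms(2) by (metis comp_apply funpow_add le_add_diff_inverse2)
  ultimately show ?thesis by (simp add: theta_digit_def theta_digit1_def)
qed

text \<open>A maximum up to \<open>N\<close> is reached either at one of finitely many early indices, whose contribution
  disappears as \<open>\<phi>\<close> grows, or at a late index \<open>n \<le> N\<close>, where the bound \<open>e * \<phi> n\<close> is at most \<open>e * \<phi> N\<close>.\<close>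

lemma limsup_theta_max_digit_eq_0:
  fixes \<phi> :: "nat \<Rightarrow> real"
  assumes \<theta>: "0 < \<theta>" and x: "0 \<le> x"
    and pos: "\<And>n. 1 \<le> n \<Longrightarrow> 0 < \<phi> n"
    and mono: "\<And>i j. 1 \<le> i \<Longrightarrow> i \<le> j \<Longrightarrow> \<phi> i \<le> \<phi> j"
    and lim: "filterlim \<phi> at_top sequentially"
    and small: "\<And>j. eventually
      (\<lambda>n. theta_digit \<theta> (Suc n) x < ereal (1 / real (Suc j) * \<phi> (Suc n))) sequentially"
  shows "limsup (\<lambda>N. theta_max_digit \<theta> N x / ereal (\<phi> N)) = 0"
proof (rule antisym)
  show "limsup (\<lambda>N. theta_max_digit \<theta> N x / ereal (\<phi> N)) \<le> 0"
  proof (rule ereal_le_epsilon2)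
    fix e :: real assume "0 < e"
    then obtain j where j: "1 / real (Suc j) < e"
      using reals_Archimedean[of e] by (auto simp: inverse_eq_divide)
    obtain n0 where n0: "\<And>n. n0 \<le> n \<Longrightarrow>
        theta_digit \<theta> (Suc n) x < ereal (1 / real (Suc j) * \<phi> (Suc n))"
      using small[of j] by (auto simp: eventually_sequentially)
    have late: "theta_digit \<theta> n x \<le> ereal (e * \<phi> n)" if "n0 < n" for n
    proof -
      have "1 / real (Suc j) * \<phi> n \<le> e * \<phi> n"
        using j pos[of n] that by (intro mult_right_mono) auto
      moreover have "theta_digit \<theta> n x < ereal (1 / real (Suc j) * \<phi> n)"
        using n0[of "n - 1"] that by simp
      ultimately show ?thesis by (meson ereal_less_eq(3) less_imp_le order_trans)
    qed
    define r where "r n = real_of_ereal (theta_digit \<theta> n x)" for n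
    have r: "theta_digit \<theta> n x = ereal (r n)" if "n \<in> {1..n0}" for n
    proof -
      have "theta_digit \<theta> n x \<noteq> \<infinity>"
        using theta_digit_infinity_stays[of \<theta> "n - 1" x n0] n0[of n0] that by auto
      then show ?thesis
        by (auto simp: r_def theta_digit_def theta_digit1_def)
    qed
    define C where "C = (\<Sum>n\<in>{1..n0}. \<bar>r n\<bar>)"
    have early: "theta_digit \<theta> n x \<le> ereal C" if "n \<in> {1..n0}" for n
    proof -
      have "\<bar>r n\<bar> \<le> C" unfolding C_def using that by (intro member_le_sum) auto
      then show ?thesis using r[OF that] by simp
    qed
    have "eventually (\<lambda>N. C / e \<le> \<phi> N) sequentially"
      using lim by (simp add: filterlim_at_top)
    then have "eventually (\<lambda>N. theta_max_digit \<theta> N x / ereal (\<phi> N) \<le> ereal e) sequentially"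
      using eventually_ge_at_top[of 1]
    proof eventually_elim
      case (elim N)
      then have C: "C \<le> e * \<phi> N" using \<open>0 < e\<close> by (simp add: field_simps)
      have "theta_digit \<theta> n x \<le> ereal (e * \<phi> N)" if "n \<in> {1..N}" for n
      proof (cases "n \<le> n0")
        case True
        then have "theta_digit \<theta> n x \<le> ereal C" using early[of n] that by simp
        also have "ereal C \<le> ereal (e * \<phi> N)" using C by simp
        finally show ?thesis .
      next
        case False
        then have "theta_digit \<theta> n x \<le> ereal (e * \<phi> n)" using late[of n] by simp
        also have "\<dots> \<le> ereal (e * \<phi> N)" using mono[of n N] that \<open>0 < e\<close> by simp
        finally show ?thesis .
      qed
      then have "theta_max_digit \<theta> N x \<le> ereal (e * \<phi> N)"
        using elim by (simp add: theta_max_digit_def)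
      then show ?case
        using pos[of N] elim by (simp add: ereal_divide_le_pos mult.commute)
    qed
    then show "limsup (\<lambda>N. theta_max_digit \<theta> N x / ereal (\<phi> N)) \<le> 0 + ereal e"
      by (simp add: Limsup_bounded)
  qed
  have "eventually (\<lambda>N. 0 \<le> theta_max_digit \<theta> N x / ereal (\<phi> N)) sequentially"
    using eventually_ge_at_top[of 1]
  proof eventually_elim
    case (elim N)
    have "0 \<le> theta_digit \<theta> 1 x"
      using \<theta> x by (simp add: theta_digit_def theta_digit1_def)
    also have "\<dots> \<le> theta_max_digit \<theta> N x"
      unfolding theta_max_digit_def using elim by (intro Max_ge) auto
    finally show ?case using pos[of N] elim by simp
  qed
  then show "0 \<le> limsup (\<lambda>N. theta_max_digit \<theta> N x / ereal (\<phi> N))"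
    by (intro le_Limsup) auto
qed

lemma limsup_theta_max_digit_eq_infinity:
  fixes \<phi> :: "nat \<Rightarrow> real"
  assumes pos: "\<And>n. 1 \<le> n \<Longrightarrow> 0 < \<phi> n"
    and large: "\<And>j. frequently
      (\<lambda>n. ereal (real (Suc j) * \<phi> (Suc n)) \<le> theta_digit \<theta> (Suc n) x) sequentially"
  shows "limsup (\<lambda>N. theta_max_digit \<theta> N x / ereal (\<phi> N)) = \<infinity>"
proof (rule ereal_top)
  fix B :: real
  let ?f = "\<lambda>N. theta_max_digit \<theta> N x / ereal (\<phi> N)"
  obtain j :: nat where j: "B \<le> real j" using real_arch_simple by blast
  have "frequently (\<lambda>n. ereal B \<le> ?f (Suc n)) sequentially"
    using large[of j]
  proof (rule frequently_elim1)
    fix n assume n: "ereal (real (Suc j) * \<phi> (Suc n)) \<le> theta_digit \<theta> (Suc n) x"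
    have p: "0 < \<phi> (Suc n)" by (simp add: pos)
    have "B * \<phi> (Suc n) \<le> real (Suc j) * \<phi> (Suc n)"
      using j p by (intro mult_right_mono) auto
    then have "ereal (B * \<phi> (Suc n)) \<le> theta_digit \<theta> (Suc n) x"
      using n by (meson ereal_less_eq(3) order_trans)
    also have "\<dots> \<le> theta_max_digit \<theta> (Suc n) x"
      unfolding theta_max_digit_def by (intro Max_ge) auto
    finally show "ereal B \<le> ?f (Suc n)"
      using p by (simp add: ereal_le_divide_pos mult.commute)
  qed
  then have freq: "frequently (\<lambda>N. ereal B \<le> ?f N) sequentially"
    using eventually_sequentially_Suc[of "\<lambda>N. \<not> ereal B \<le> ?f N"]
    by (simp add: frequently_def)
  show "ereal B \<le> limsup ?f"
  proof (rule ccontr)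
    assume "\<not> ereal B \<le> limsup ?f"
    then have "eventually (\<lambda>N. ?f N < ereal B) sequentially"
      by (intro Limsup_lessD) simp
    then show False using freq by (simp add: frequently_def not_le)
  qed
qed

section \<open>The zero-infinity dichotomy\<close>

theorem corollary5p4:
  fixes m :: nat and \<theta> :: real and \<phi> :: "nat \<Rightarrow> real"
  assumes "m \<ge> 1"
    and "\<theta> = 1 / sqrt (real m)"
    and "\<And>n. n \<ge> 1 \<Longrightarrow> \<phi> n > 0"
    and "\<And>i j. 1 \<le> i \<Longrightarrow> i \<le> j \<Longrightarrow> \<phi> i \<le> \<phi> j"
  shows "AE x in lebesgue_on {0..\<theta>}.
           limsup (\<lambda>N. theta_max_digit \<theta> N x / ereal (\<phi> N)) = 0 \<or>
           limsup (\<lambda>N. theta_max_digit \<theta> N x / ereal (\<phi> N)) = \<infinity>"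
proof -
  interpret theta_expansion m \<theta>
    using assms by unfold_locales
  have pos: "0 < \<phi> (Suc n)" for n using assms(3) by simp
  show ?thesis
  proof (cases "summable (\<lambda>n. 1 / \<phi> (Suc n))")
    case True
    have "filterlim (\<lambda>n. inverse (1 / \<phi> (Suc n))) at_top sequentially"
      using summable_LIMSEQ_zero[OF True] pos by (intro filterlim_inverse_at_top) auto
    then have lim: "filterlim \<phi> at_top sequentially"
      by (simp add: filterlim_sequentially_Suc)
    have "AE x in lebesgue_on {0..\<theta>}. eventually
        (\<lambda>n. theta_digit \<theta> (Suc n) x < ereal (1 / real (Suc j) * \<phi> (Suc n))) sequentially" for j
    proof (rule AE_digits_eventually_less)
      show "summable (\<lambda>n. 1 / (1 / real (Suc j) * \<phi> (Suc n)))"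
        using summable_mult[OF True, of "real (Suc j)"] by simp
    qed (simp add: pos)
    then have "AE x in lebesgue_on {0..\<theta>}. \<forall>j. eventually
        (\<lambda>n. theta_digit \<theta> (Suc n) x < ereal (1 / real (Suc j) * \<phi> (Suc n))) sequentially"
      by (subst AE_all_countable) blast
    then show ?thesis
      using AE_space
    proof eventually_elim
      case (elim x)
      then show ?case
        using limsup_theta_max_digit_eq_0[OF theta_pos _ assms(3,4) lim, of x] by simp
    qed
  next
    case False
    have "AE x in lebesgue_on {0..\<theta>}. frequently
        (\<lambda>n. ereal (real (Suc j) * \<phi> (Suc n)) \<le> theta_digit \<theta> (Suc n) x) sequentially" for j
    proof (rule AE_digits_frequently_ge)
      let ?C = "real (Suc j) + 1 / \<phi> 1"
      show "\<not> summable (\<lambda>n. 1 / (real (Suc j) * \<phi> (Suc n) + 1))"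
      proof
        assume "summable (\<lambda>n. 1 / (real (Suc j) * \<phi> (Suc n) + 1))"
        then have "summable (\<lambda>n. ?C * (1 / (real (Suc j) * \<phi> (Suc n) + 1)))"
          by (rule summable_mult)
        then have "summable (\<lambda>n. 1 / \<phi> (Suc n))"
        proof (rule summable_comparison_test'[where N = 0])
          fix n
          \<comment> \<open>As \<open>\<phi>\<close> is bounded below by \<open>\<phi> 1\<close>, adding \<open>1\<close> changes the terms by a bounded factor.\<close>
          have "1 \<le> \<phi> (Suc n) / \<phi> 1" using assms(3,4) by (simp add: field_simps)
          then have "real (Suc j) * \<phi> (Suc n) + 1 \<le> ?C * \<phi> (Suc n)"
            by (simp add: algebra_simps)
          moreover have "0 < real (Suc j) * \<phi> (Suc n) + 1"
            using pos[of n] by (intro add_pos_pos mult_pos_pos) auto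
          ultimately show "norm (1 / \<phi> (Suc n)) \<le> ?C * (1 / (real (Suc j) * \<phi> (Suc n) + 1))"
            using pos[of n] by (simp add: divide_le_eq le_divide_eq mult.commute)
        qed
        then show False using False by contradiction
      qed
    qed (simp add: pos)
    then have "AE x in lebesgue_on {0..\<theta>}. \<forall>j. frequently
        (\<lambda>n. ereal (real (Suc j) * \<phi> (Suc n)) \<le> theta_digit \<theta> (Suc n) x) sequentially"
      by (subst AE_all_countable) blast
    then show ?thesis
    proof eventually_elim
      case (elim x)
      then show ?case
        using limsup_theta_max_digit_eq_infinity[where x = x, OF assms(3)] by simp
    qed
  qed
qed

end
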